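(* Let $n\ge 2$ be an integer and let $f_{1,n}(x)=x^{n-1}+2x^{n-2}+3x^{n-3}+\cdots+(n-1)x+n$. The discriminant of $f_{1,n}(x)$ is $$D(f_{1,n}(x))=(-1)^{\frac{(n-1)(n+2)}{2}}\,2\,n^{n-3}(n+1)^{n-2},$$ and if $n\equiv 0$ or $3 \pmod 4$ it is negative, hence not the square of a rational number. Moreover, for $n>2$, let $K_n$ be the minimal splitting field of $f_{1,n}(x)$ over $\mathbb{Q}$; write $n=4l$, $4l+1$, $4l+2$ or $4l+3$ with $l$ an integer, and, in the cases $n=4l+1$ and $n=4l+2$, assume that $2l+1$ is square-free. Then $K_n$ contains the quadratic field $F$ as a subfield, where $$F=\begin{cases}\mathbb{Q}(\sqrt{-2l}) & (n=4l)\\ \mathbb{Q}(\sqrt{2l+1}) & (n=4l+1)\\ \mathbb{Q}(\sqrt{2l+1}) & (n=4l+2)\\ \mathbb{Q}(\sqrt{-2(l+1)}) & (n=4l+3).\end{cases}$$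
   Context: For a positive integer $n$, $f_{1,n}(x)=\sum_{k=1}^{n} k\,x^{n-k}\in\mathbb{Z}[x]$, a monic polynomial of degree $n-1$. The discriminant of a monic polynomial with roots $\alpha_1,\dots,\alpha_d$ is $\prod_{i<j}(\alpha_i-\alpha_j)^2$ (equal to $1$ for degree $1$). *)

theory Defs
  imports
    "HOL-Computational_Algebra.Computational_Algebra"
    "HOL-Algebra.Generated_Fields"
    "HOL-Algebra.Embedded_Algebras"
    "HOL-Algebra.Algebraic_Closure_Type"
begin

definition f1 :: "nat \<Rightarrow> int poly" where
  "f1 n = (\<Sum>k = 1..n. Polynomial.monom (int k) (n - k))"

definition complex_roots :: "int poly \<Rightarrow> complex multiset" where
  "complex_roots p = proots (map_poly of_int p)"

text \<open>Intended for monic polynomials only (there is no leading-coefficient factor).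
  The roots are listed with multiplicity; the product does not depend on the chosen
  enumeration.\<close>

definition discriminant :: "int poly \<Rightarrow> complex" where
  "discriminant p =
     (let as = (SOME as. mset as = complex_roots p)
      in \<Prod>(i, j) \<in> {(i, j). i < j \<and> j < length as}. (as ! i - as ! j)\<^sup>2)"

text \<open>Number fields are taken inside the complex numbers, viewed as a field in the sense
  of HOL-Algebra.\<close>

abbreviation CC :: "complex ring" where
  "CC \<equiv> ring_of_type_algebra"

definition Q_adjoin :: "complex set \<Rightarrow> complex set" where
  "Q_adjoin S = generate_field CC (\<rat> \<union> S)"

text \<open>Since the complex numbers are algebraically closed, the minimal splitting field is
  obtained by adjoining all complex roots.\<close>

definition splitting_field :: "int poly \<Rightarrow> complex set" where
  "splitting_field p = Q_adjoin (set_mset (complex_roots p))"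

definition quadratic_field :: "complex set \<Rightarrow> bool" where
  "quadratic_field F \<longleftrightarrow> subfield F CC \<and> ring.dimension CC 2 \<rat> F"

end

(* Multiplying f = f_{1,n} by (x - 1)^2 gives the trinomial x^(n+1) - (n+1) x + n.  Differentiating
   this product at a root a of f yields f'(a) a (a - 1) = n (n + 1).  The product of f'(a) over all
   roots is, up to sign, the discriminant, while the products of a and of a - 1 are, up to sign, the
   values f(0) = n and f(1) = n (n + 1) / 2.  The product of the root differences lies in the
   splitting field and is a square root of the discriminant, which is a rational square times the
   radicand of the quadratic field. *)
theory Submission
  imports Defs
begin

section \<open>Discriminants as products of derivative values\<close>

lemma prod_pairs_less_Suc:
  fixes h :: "nat \<Rightarrow> nat \<Rightarrow> 'a :: comm_monoid_mult"
  shows "(\<Prod>(i, j) \<in> {(i, j). i < j \<and> j < Suc m}. h i j) =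
         (\<Prod>(i, j) \<in> {(i, j). i < j \<and> j < m}. h i j) * (\<Prod>i<m. h i m)"
proof -
  have fin: "finite {(i, j). i < j \<and> j < m}"
    by (rule finite_subset[of _ "{..<m} \<times> {..<m}"]) auto
  have "{(i, j). i < j \<and> j < Suc m} = {(i, j). i < j \<and> j < m} \<union> (\<lambda>i. (i, m)) ` {..<m}"
    by auto
  moreover have "(\<Prod>(i, j) \<in> (\<lambda>i. (i, m)) ` {..<m}. h i j) = (\<Prod>i<m. h i m)"
    by (subst prod.reindex) (auto simp: inj_on_def)
  moreover have "{(i, j). i < j \<and> j < m} \<inter> (\<lambda>i. (i, m)) ` {..<m} = {}"
    by auto
  ultimately show ?thesis
    using fin by (simp add: prod.union_disjoint)
qed

text \<open>Each pair i < j enters the double product as (a i - a j)(a j - a i) = -(a i - a j)^2, so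
  every pair costs one sign.\<close>

lemma prod_square_differences:
  fixes a :: "nat \<Rightarrow> 'a :: comm_ring_1"
  shows "(\<Prod>(i, j) \<in> {(i, j). i < j \<and> j < m}. (a i - a j)\<^sup>2) =
         (-1) ^ (m choose 2) * (\<Prod>i<m. \<Prod>j\<in>{..<m} - {i}. a i - a j)"
proof (induction m)
  case 0
  show ?case by (simp add: numeral_2_eq_2)
next
  case (Suc m)
  have "(\<Prod>j\<in>{..<Suc m} - {i}. a i - a j) = (\<Prod>j\<in>{..<m} - {i}. a i - a j) * (a i - a m)"
    if "i < m" for i
  proof -
    have "{..<Suc m} - {i} = insert m ({..<m} - {i})"
      using that by auto
    then show ?thesis by (simp add: mult.commute)
  qed
  moreover have "{..<Suc m} - {m} = {..<m}" by auto
  ultimately have "(\<Prod>i<Suc m. \<Prod>j\<in>{..<Suc m} - {i}. a i - a j) =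
      (\<Prod>i<m. \<Prod>j\<in>{..<m} - {i}. a i - a j) * (\<Prod>i<m. a i - a m) * (\<Prod>j<m. a m - a j)"
    by (simp add: prod.distrib)
  \<comment> \<open>The m pairs containing the new index give the sign (-1)^m, which matches the
    growth of the binomial coefficient from m to m + 1.\<close>
  moreover have "(\<Prod>j<m. a m - a j) = (-1) ^ m * (\<Prod>i<m. a i - a m)"
  proof -
    have "(\<Prod>j<m. a m - a j) = (\<Prod>j<m. (-1) * (a j - a m))" by simp
    also have "\<dots> = (-1) ^ m * (\<Prod>i<m. a i - a m)" by (subst prod.distrib) simp
    finally show ?thesis .
  qed
  moreover have "(-1 :: 'a) ^ m * (-1) ^ m = 1"
    by (simp flip: power_mult_distrib)
  moreover have "(Suc m choose 2) = m + (m choose 2)"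
    by (simp add: numeral_2_eq_2)
  moreover have "(\<Prod>i<m. (a i - a m)\<^sup>2) = (\<Prod>i<m. a i - a m)\<^sup>2"
    by (simp add: prod_power_distrib)
  \<comment> \<open>Used with s = (-1)^m, c = (-1)^(m choose 2), A the old double product and B the
    product of the a i - a m.\<close>
  moreover have "(s * c) * (A * B * (s * B)) = (s * s) * (c * A * B\<^sup>2)" for s c A B :: 'a
    by (simp only: power2_eq_square mult_ac)
  ultimately show ?case
    unfolding prod_pairs_less_Suc Suc.IH by (simp only: power_add mult_1_left)
qed

lemma poly_pderiv_prod_linear:
  fixes a :: "nat \<Rightarrow> 'a :: idom"
  assumes "i < m"
  shows "poly (pderiv (\<Prod>j<m. [:- a j, 1:])) (a i) = (\<Prod>j\<in>{..<m} - {i}. a i - a j)"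
proof -
  have "poly (pderiv (\<Prod>j<m. [:- a j, 1:])) (a i) =
        (\<Sum>k<m. \<Prod>j\<in>{..<m} - {k}. a i - a j)"
    by (simp add: pderiv_prod poly_sum poly_prod pderiv_pCons)
  \<comment> \<open>Every summand of the product rule with k different from i keeps the vanishing
    factor a i - a i.\<close>
  also have "\<dots> = (\<Sum>k\<in>{i}. \<Prod>j\<in>{..<m} - {k}. a i - a j)"
    using assms by (intro sum.mono_neutral_right) (auto intro!: prod_zero)
  finally show ?thesis by simp
qed


text \<open>Exposes the enumeration hidden in the choice operator, so that the discriminant and the
  linear factorisation refer to the same list of roots.\<close>

lemma discriminant_eq_prod_roots:
  assumes "lead_coeff p = 1"
  obtains as where "mset as = complex_roots p" "length as = degree p"
    "map_poly of_int p = (\<Prod>i<length as. [:- (as ! i), 1:])"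
    "discriminant p = (\<Prod>(i, j) \<in> {(i, j). i < j \<and> j < length as}. (as ! i - as ! j)\<^sup>2)"
proof -
  define P :: "complex poly" where "P = map_poly of_int p"
  define as where "as = (SOME as. mset as = complex_roots p)"
  have as: "mset as = complex_roots p"
    unfolding as_def by (rule someI_ex) (rule ex_mset)
  have deg: "degree P = degree p"
    by (simp add: P_def degree_map_poly)
  then have lead: "lead_coeff P = 1"
    using assms by (simp add: P_def coeff_map_poly)
  have "size (complex_roots p) = degree p"
    by (simp add: complex_roots_def size_proots_complex degree_map_poly)
  then have len: "length as = degree p"
    using as by (metis size_mset)
  have "P = (\<Prod>x\<in>#complex_roots p. [:- x, 1:])"
    using complex_poly_decompose_multiset[of P] lead by (simp add: complex_roots_def P_def)
  also have "\<dots> = prod_list (map (\<lambda>x. [:- x, 1:]) as)"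
    by (simp flip: as prod_mset_prod_list)
  also have "\<dots> = (\<Prod>i<length as. [:- (as ! i), 1:])"
    by (simp add: prod.list_conv_set_nth atLeast0LessThan)
  finally have "P = (\<Prod>i<length as. [:- (as ! i), 1:])" .
  then show thesis
    using that[OF as len] by (simp add: P_def discriminant_def Let_def as_def)
qed

section \<open>Recursion, special values and discriminant of f_{1,n}\<close>

lemma f1_0: "f1 0 = 0"
  by (simp add: f1_def)

text \<open>Horner form: multiplication by x lowers no index k but raises each exponent n - k by
  one. It drives the inductions on n below.\<close>

lemma f1_Suc: "f1 (Suc n) = pCons (int (Suc n)) (f1 n)"
proof -
  have "f1 (Suc n) = (\<Sum>k = 1..n. Polynomial.monom (int k) (Suc n - k)) + [:int (Suc n):]"
    by (simp add: f1_def monom_0)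
  also have "(\<Sum>k = 1..n. Polynomial.monom (int k) (Suc n - k)) =
             (\<Sum>k = 1..n. [:0, 1:] * Polynomial.monom (int k) (n - k))"
    by (intro sum.cong) (auto simp: Suc_diff_le monom_Suc)
  also have "\<dots> = pCons 0 (f1 n)"
    unfolding f1_def sum_distrib_left[symmetric] by simp
  finally show ?thesis by simp
qed

lemma
  assumes "n \<ge> 1"
  shows degree_f1: "degree (f1 n) = n - 1" and lead_coeff_f1: "lead_coeff (f1 n) = 1"
proof -
  \<comment> \<open>Nonvanishing is carried along because the degree of \<open>pCons\<close> depends
    on whether the tail is zero.\<close>
  have "f1 (Suc m) \<noteq> 0 \<and> degree (f1 (Suc m)) = m \<and> lead_coeff (f1 (Suc m)) = 1" for m
    by (induction m) (auto simp: f1_0 f1_Suc[of "Suc _"] f1_Suc[of 0] coeff_pCons split: nat.splits)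
  from this[of "n - 1"] show "degree (f1 n) = n - 1" "lead_coeff (f1 n) = 1"
    using assms by auto
qed

lemma poly_f1_times_square:
  fixes x :: complex
  shows "poly (map_poly of_int (f1 n)) x * (x - 1)\<^sup>2 =
         x ^ Suc n - of_nat (Suc n) * x + of_nat n"
proof (induction n)
  case 0
  then show ?case by (simp add: f1_0)
next
  case (Suc n)
  have "poly (map_poly of_int (f1 (Suc n))) x * (x - 1)\<^sup>2 =
        of_nat (Suc n) * (x - 1)\<^sup>2 + x * (poly (map_poly of_int (f1 n)) x * (x - 1)\<^sup>2)"
    by (simp add: f1_Suc map_poly_pCons algebra_simps)
  also have "\<dots> = of_nat (Suc n) * (x - 1)\<^sup>2 + x * (x ^ Suc n - of_nat (Suc n) * x + of_nat n)"
    unfolding Suc.IH ..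
  finally show ?case
    by (simp add: algebra_simps power2_eq_square)
qed

lemma f1_times_square:
  "map_poly of_int (f1 n) * [:-1, 1:]\<^sup>2 =
   Polynomial.monom 1 (Suc n) - [:- of_nat n, of_nat (Suc n) :: complex:]"
  by (rule poly_ext) (use poly_f1_times_square[of n] in \<open>simp add: poly_monom algebra_simps\<close>)

text \<open>The coefficient sum is a triangular number. The trinomial identity reads 0 = 0 at x = 1,
  so the recursion is used instead.\<close>

lemma poly_f1_1: "poly (map_poly of_int (f1 n)) (1 :: complex) = of_nat n * of_nat (Suc n) / 2"
  by (induction n) (simp_all add: f1_Suc map_poly_pCons f1_0 field_simps)

lemma poly_f1_0: "poly (map_poly of_int (f1 n)) (0 :: complex) = of_nat n"
  by (cases n) (simp_all add: f1_Suc map_poly_pCons f1_0)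

lemma poly_pderiv_f1_root:
  fixes x :: complex
  assumes "n \<ge> 1" and root: "poly (map_poly of_int (f1 n)) x = 0"
  shows "poly (pderiv (map_poly of_int (f1 n))) x * (x * (x - 1)) = of_nat n * of_nat (Suc n)"
proof -
  define F :: "complex poly" where "F = map_poly of_int (f1 n)"
  have "poly (pderiv (F * [:-1, 1:]\<^sup>2)) x = of_nat (Suc n) * (x ^ n - 1)"
    unfolding F_def f1_times_square
    by (simp add: pderiv_diff pderiv_monom pderiv_pCons poly_monom algebra_simps)
  moreover have "poly (pderiv (F * [:-1, 1:]\<^sup>2)) x = poly (pderiv F) x * (x - 1)\<^sup>2"
    using root by (simp add: pderiv_mult F_def)
  \<comment> \<open>The extra factor x produces x^(n+1), which the trinomial makes linear at a root;
    the right side becomes n(n+1)(x - 1), and one factor x - 1 cancels.\<close>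
  ultimately have "poly (pderiv F) x * (x - 1)\<^sup>2 * x = of_nat (Suc n) * (x ^ n - 1) * x"
    by metis
  also have "\<dots> = of_nat (Suc n) * (x ^ Suc n - x)"
    by (simp add: algebra_simps)
  also have "x ^ Suc n = of_nat (Suc n) * x - of_nat n"
    using poly_f1_times_square[of n x] root by (simp add: algebra_simps)
  finally have "(x - 1) * (poly (pderiv F) x * (x * (x - 1)) - of_nat n * of_nat (Suc n)) = 0"
    by (simp add: algebra_simps power2_eq_square)
  moreover have "x \<noteq> 1"
    using assms poly_f1_1[of n] by (auto simp del: of_nat_Suc)
  ultimately show ?thesis by (simp add: F_def)
qed

lemma discriminant_f1:
  assumes "n \<ge> 2"
  shows "discriminant (f1 n) =
       (-1) ^ ((n - 1) * (n + 2) div 2) * 2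
         * of_nat n powi (int n - 3) * of_nat (n + 1) ^ (n - 2)"
proof -
  define F :: "complex poly" where "F = map_poly of_int (f1 n)"
  from assms have "n \<ge> 1" by simp
  from discriminant_eq_prod_roots[OF lead_coeff_f1[OF this], folded F_def] obtain as where
    "mset as = complex_roots (f1 n)" and len: "length as = degree (f1 n)"
    and F: "F = (\<Prod>i<length as. [:- (as ! i), 1:])" and disc: "discriminant (f1 n) =
      (\<Prod>(i, j) \<in> {(i, j). i < j \<and> j < length as}. (as ! i - as ! j)\<^sup>2)" .
  define P where "P = (\<Prod>i<n - 1. poly (pderiv F) (as ! i))"
  have len': "length as = n - 1"
    using len degree_f1[OF \<open>n \<ge> 1\<close>] by simp
  have disc_P: "discriminant (f1 n) = (-1) ^ (n - 1 choose 2) * P"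
    unfolding disc prod_square_differences P_def F len'
    by (intro arg_cong2[of _ _ _ _ "(*)"] prod.cong refl poly_pderiv_prod_linear[symmetric]) auto
  have eval: "poly F x = (\<Prod>i<n - 1. x - as ! i)" for x
    by (simp add: F poly_prod len')
  \<comment> \<open>No sign remains: for each root a, (0 - a)(1 - a) = a(a - 1).\<close>
  have "P * (poly F 0 * poly F 1) =
        (\<Prod>i<n - 1. poly (pderiv F) (as ! i) * (as ! i * (as ! i - 1)))"
    unfolding P_def eval prod.distrib[symmetric] by (intro prod.cong) (auto simp: algebra_simps)
  also have "\<dots> = (\<Prod>i<n - 1. of_nat n * of_nat (Suc n))"
  proof (intro prod.cong refl)
    fix i assume "i \<in> {..<n - 1}"
    then have "poly F (as ! i) = 0" by (auto simp: eval)
    then show "poly (pderiv F) (as ! i) * (as ! i * (as ! i - 1)) = of_nat n * of_nat (Suc n)"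
      using poly_pderiv_f1_root[OF \<open>n \<ge> 1\<close>] by (simp add: F_def)
  qed
  finally have P: "P * (of_nat n * (of_nat n * of_nat (Suc n) / 2)) =
      (of_nat n * of_nat (Suc n)) ^ (n - 1)"
    unfolding F_def poly_f1_0 poly_f1_1 by simp
  obtain k where k: "n = Suc (Suc k)"
    using assms by (metis add_2_eq_Suc le_Suc_ex)
  define x y :: complex where "x = of_nat n" and "y = of_nat (Suc n)"
  have [simp]: "x \<noteq> 0" "y \<noteq> 0" by (simp_all add: x_def y_def k del: of_nat_Suc)
  \<comment> \<open>The quotient form also covers n = 2, where the exponent is -1.\<close>
  have "x powi (int n - 3) = x ^ k / x"
    by (simp add: k power_int_diff)
  moreover have "P * (x * (x * y / 2)) = (x * y) ^ (n - 1)"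
    using P by (simp add: x_def y_def)
  ultimately have "P = 2 * x powi (int n - 3) * y ^ (n - 2)"
    by (simp only:) (simp add: k power_mult_distrib field_simps)
  \<comment> \<open>The two sign exponents differ by an even number.\<close>
  moreover have "(n - 1) * (n + 2) div 2 = (n - 1 choose 2) + 2 * (n - 1)"
  proof -
    have "(n - 1) * (n + 2) = (n - 1) * (n - 1 - 1) + 2 * (2 * (n - 1))"
      by (simp add: k algebra_simps)
    then show ?thesis by (simp add: choose_two)
  qed
  ultimately show ?thesis
    unfolding disc_P x_def y_def by (simp add: power_add power_mult)
qed

text \<open>Only n modulo 4 matters: with n - 1 = 4l + r, each case writes (n - 1)(n + 2) as twice a
  visibly even or odd number.\<close>

lemma even_sign_exponent:
  fixes n :: nat
  assumes "n \<ge> 1"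
  shows "even ((n - 1) * (n + 2) div 2) \<longleftrightarrow> n mod 4 = 1 \<or> n mod 4 = 2"
proof -
  obtain k where k: "n = Suc k"
    using assms by (cases n) auto
  obtain l r where lr: "k = 4 * l + r" "r < 4"
    by (metis mod_less_divisor mult_div_mod_eq zero_less_numeral)
  then consider "r = 0" | "r = 1" | "r = 2" | "r = 3" by linarith
  then show ?thesis
  proof cases
    case 1
    then have e: "(n - 1) * (n + 2) = 2 * (2 * (l * (4 * l + 3)))"
      using lr k by (simp add: algebra_simps)
    have "n mod 4 = 1"
      using 1 lr k by presburger
    then show ?thesis unfolding e by simp
  next
    case 2
    then have e: "(n - 1) * (n + 2) = 2 * (2 * ((4 * l + 1) * (l + 1)))"
      using lr k by (simp add: algebra_simps)
    have "n mod 4 = 2"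
      using 2 lr k by presburger
    then show ?thesis unfolding e by simp
  next
    case 3
    then have e: "(n - 1) * (n + 2) = 2 * (2 * ((2 * l + 1) * (2 * l + 2) + l) + 1)"
      using lr k by (simp add: algebra_simps)
    have "n mod 4 = 3"
      using 3 lr k by presburger
    then show ?thesis unfolding e by simp
  next
    case 4
    then have e: "(n - 1) * (n + 2) = 2 * (2 * ((2 * l + 1) * (2 * l + 3) + l + 1) + 1)"
      using lr k by (simp add: algebra_simps)
    have "n mod 4 = 0"
      using 4 lr k by presburger
    then show ?thesis unfolding e by simp
  qed
qed

text \<open>With natural exponents and an explicit sign, squares can be split off according to n
  modulo 4.\<close>

lemma discriminant_f1_power:
  assumes "n \<ge> 3"
  shows "discriminant (f1 n) =
    (if n mod 4 = 1 \<or> n mod 4 = 2 then 2 else -2) * of_nat n ^ (n - 3) * of_nat (n + 1) ^ (n - 2)"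
proof -
  have "int n - 3 = int (n - 3)"
    using assms by simp
  then have "(of_nat n :: complex) powi (int n - 3) = of_nat n ^ (n - 3)"
    by (simp only: power_int_of_nat)
  then show ?thesis
    using assms discriminant_f1[of n] even_sign_exponent[of n] by simp
qed

section \<open>Subfields of the complex numbers and quadratic extensions\<close>

lemma ring_of_type_algebra_simps [simp]:
  "carrier CC = UNIV" "x \<otimes>\<^bsub>CC\<^esub> y = x * y" "x \<oplus>\<^bsub>CC\<^esub> y = x + y" "\<one>\<^bsub>CC\<^esub> = 1" "\<zero>\<^bsub>CC\<^esub> = 0"
  by (simp_all add: ring_of_type_algebra_def)

lemma field_CC: "field CC"
  by (rule field_from_type_algebra)

lemma ring_CC: "ring CC"
  by (rule ring_from_type_algebra)

lemma a_inv_CC [simp]: "\<ominus>\<^bsub>CC\<^esub> x = - x"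
  using abelian_group.minus_equality[OF ring.is_abelian_group[OF ring_CC], of "-x" x] by simp

lemma m_inv_CC [simp]: "x \<noteq> 0 \<Longrightarrow> inv\<^bsub>CC\<^esub> x = inverse x"
  using comm_monoid.comm_inv_char[OF cring.axioms(2)[OF cring_from_type_algebra], of x "inverse x"]
  by simp

text \<open>Turns the algebraic notion into closure conditions on ordinary complex operations. Zero
  may be included under \<open>inverse\<close> since \<open>inverse 0 = 0\<close>.\<close>

lemma subfield_CC_iff:
  "subfield K CC \<longleftrightarrow> 1 \<in> K \<and> (\<forall>x\<in>K. \<forall>y\<in>K. x + y \<in> K \<and> x * y \<in> K) \<and>
     (\<forall>x\<in>K. - x \<in> K \<and> inverse x \<in> K)"
proof
  assume K: "subfield K CC"
  note R = subfieldE(1)[OF K]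
  have "inverse x \<in> K" if "x \<in> K" for x
    using ring.subfield_m_inv(1)[OF ring_CC K, of x] that subringE(2)[OF R]
    by (cases "x = 0") auto
  then show "1 \<in> K \<and> (\<forall>x\<in>K. \<forall>y\<in>K. x + y \<in> K \<and> x * y \<in> K) \<and>
     (\<forall>x\<in>K. - x \<in> K \<and> inverse x \<in> K)"
    using subringE[OF R] by auto
next
  assume K: "1 \<in> K \<and> (\<forall>x\<in>K. \<forall>y\<in>K. x + y \<in> K \<and> x * y \<in> K) \<and>
     (\<forall>x\<in>K. - x \<in> K \<and> inverse x \<in> K)"
  then show "subfield K CC"
    by (intro field.subfieldI'[OF field_CC] ring.subringI[OF ring_CC]) auto
qed

lemma subfield_Q_adjoin: "subfield (Q_adjoin S) CC"
  unfolding Q_adjoin_def by (rule field.generate_field_is_subfield[OF field_CC]) simp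

lemma Rats_subset_Q_adjoin: "\<rat> \<subseteq> Q_adjoin S"
  and subset_Q_adjoin: "S \<subseteq> Q_adjoin S"
  by (auto simp: Q_adjoin_def intro: generate_field.incl)

lemma Q_adjoin_minimal:
  assumes "subfield K CC" "\<rat> \<subseteq> K" "S \<subseteq> K"
  shows "Q_adjoin S \<subseteq> K"
  unfolding Q_adjoin_def
  using assms by (intro field.generate_field_min_subfield1[OF field_CC]) auto

lemma prod_in_Q_adjoin:
  assumes "\<And>i. i \<in> I \<Longrightarrow> f i \<in> Q_adjoin S"
  shows "(\<Prod>i\<in>I. f i) \<in> Q_adjoin S"
  using assms subfield_Q_adjoin[of S, unfolded subfield_CC_iff]
  by (induction I rule: infinite_finite_induct) auto

lemma Q_adjoin_sqrt:
  assumes "s\<^sup>2 \<in> \<rat>" "s \<notin> \<rat>"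
  shows "Q_adjoin {s} = {a + b * s | a b. a \<in> \<rat> \<and> b \<in> \<rat>}" (is "_ = ?E")
proof
  have "subfield ?E CC"
    unfolding subfield_CC_iff
  proof (intro conjI ballI)
    show "1 \<in> ?E"
      by (rule CollectI, rule exI[of _ 1], rule exI[of _ 0]) simp
  next
    fix x y assume "x \<in> ?E" "y \<in> ?E"
    then obtain a b c d where
      *: "x = a + b * s" "y = c + d * s" "a \<in> \<rat>" "b \<in> \<rat>" "c \<in> \<rat>" "d \<in> \<rat>" by blast
    have "x + y = (a + c) + (b + d) * s"
      by (simp add: * algebra_simps)
    then show "x + y \<in> ?E"
      using * by (blast intro: Rats_add)
    have "x * y = (a * c + b * d * s\<^sup>2) + (a * d + b * c) * s"
      by (simp add: * algebra_simps power2_eq_square)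
    then show "x * y \<in> ?E"
      using * assms(1) by (blast intro: Rats_add Rats_mult)
  next
    fix x assume "x \<in> ?E"
    then obtain a b where *: "x = a + b * s" "a \<in> \<rat>" "b \<in> \<rat>" by blast
    have "- x = (- a) + (- b) * s"
      by (simp add: *)
    then show "- x \<in> ?E"
      using * by (blast intro: Rats_minus_iff[THEN iffD2])
    \<comment> \<open>The norm of x, its product with the conjugate a - b s: it is rational and
      serves to rationalise the denominator.\<close>
    define N where "N = a\<^sup>2 - b\<^sup>2 * s\<^sup>2"
    have "N \<in> \<rat>"
      unfolding N_def using * assms(1) by (intro Rats_diff Rats_mult) (simp_all add: Rats_power)
    have N: "N = x * (a - b * s)"
      by (simp add: N_def * algebra_simps power2_eq_square)
    have "inverse x = a / N + (- b / N) * s"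
    proof (cases "x = 0")
      case True
      \<comment> \<open>Here N = 0, and both sides are 0 by the convention for division by
        zero.\<close>
      then show ?thesis using N by simp
    next
      case False
      have "a - b * s \<noteq> 0"
      proof
        assume 0: "a - b * s = 0"
        then have "b \<noteq> 0" using False * by auto
        then have "s = a / b" using 0 by (simp add: field_simps)
        then show False using * assms(2) by (auto intro: Rats_divide)
      qed
      then have "inverse x = (a - b * s) / N"
        using False by (simp add: N field_simps)
      then show ?thesis by (simp add: diff_divide_distrib)
    qed
    then show "inverse x \<in> ?E"
      using * \<open>N \<in> \<rat>\<close> by (blast intro: Rats_divide Rats_minus_iff[THEN iffD2])
  qed
  moreover have "a \<in> ?E" if "a \<in> \<rat>" for a
    by (rule CollectI, rule exI[of _ a], rule exI[of _ 0]) (use that in simp)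
  moreover have "s \<in> ?E"
    by (rule CollectI, rule exI[of _ 0], rule exI[of _ 1]) simp
  ultimately show "Q_adjoin {s} \<subseteq> ?E"
    by (intro Q_adjoin_minimal) auto
  show "?E \<subseteq> Q_adjoin {s}"
    using Rats_subset_Q_adjoin[of "{s}"] subset_Q_adjoin[of "{s}"]
      subfield_Q_adjoin[of "{s}", unfolded subfield_CC_iff] by blast
qed

text \<open>The space is built from {0} by adjoining the lines through 1 and then s; each vector
  lies outside the previous space, so the dimension rises by one twice.\<close>

lemma quadratic_field_Q_adjoin_sqrt:
  assumes "s\<^sup>2 \<in> \<rat>" "s \<notin> \<rat>"
  shows "quadratic_field (Q_adjoin {s})"
proof -
  have "ring.dimension CC (Suc 0) \<rat> (ring.line_extension CC \<rat> 1 {0})"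
    by (rule ring.Suc_dim[OF ring_CC]) (use ring.zero_dim[OF ring_CC] in auto)
  also have "ring.line_extension CC \<rat> 1 {0} = \<rat>"
    by (auto simp: ring.line_extension_mem_iff[OF ring_CC])
  finally have "ring.dimension CC (Suc (Suc 0)) \<rat> (ring.line_extension CC \<rat> s \<rat>)"
    by (intro ring.Suc_dim[OF ring_CC]) (use assms in auto)
  also have "ring.line_extension CC \<rat> s \<rat> = Q_adjoin {s}"
    unfolding Q_adjoin_sqrt[OF assms]
    by (auto simp: ring.line_extension_mem_iff[OF ring_CC]) (metis add.commute)+
  finally show ?thesis
    by (simp add: quadratic_field_def subfield_Q_adjoin numeral_2_eq_2)
qed

section \<open>Quadratic subfields from the square root of the discriminant\<close>

lemma csqrt_discriminant_in_splitting_field: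
  assumes "lead_coeff p = 1" and D: "discriminant p = q\<^sup>2 * d" and q: "q \<in> \<rat>" "q \<noteq> 0"
  shows "csqrt d \<in> splitting_field p"
proof -
  note closed = subfield_Q_adjoin[of "set_mset (complex_roots p)", unfolded subfield_CC_iff,
      folded splitting_field_def]
  obtain as where as: "mset as = complex_roots p" and disc: "discriminant p =
      (\<Prod>(i, j) \<in> {(i, j). i < j \<and> j < length as}. (as ! i - as ! j)\<^sup>2)"
    by (rule discriminant_eq_prod_roots[OF assms(1)])
  define \<delta> where "\<delta> = (\<Prod>(i, j) \<in> {(i, j). i < j \<and> j < length as}. as ! i - as ! j)"
  have mem: "as ! i \<in> splitting_field p" if "i < length as" for i
    using subset_Q_adjoin[of "set_mset (complex_roots p)"] that
    unfolding splitting_field_def as[symmetric] by auto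
  have "as ! i - as ! j \<in> splitting_field p" if "i < j" "j < length as" for i j
    using closed mem[of i] mem[of j] that by (metis diff_conv_add_uminus less_trans)
  then have "\<delta> \<in> splitting_field p"
    unfolding \<delta>_def splitting_field_def by (intro prod_in_Q_adjoin) auto
  moreover have "inverse q \<in> splitting_field p"
    using q(1) Rats_subset_Q_adjoin closed unfolding splitting_field_def by blast
  ultimately have \<delta>_q: "\<delta> * inverse q \<in> splitting_field p"
    using closed by blast
  have "\<delta>\<^sup>2 = q\<^sup>2 * d"
    unfolding D[symmetric] disc \<delta>_def by (simp add: prod_power_distrib[symmetric] case_prod_unfold)
  then have "(csqrt d)\<^sup>2 = (\<delta> * inverse q)\<^sup>2"
    using q(2) by (simp add: field_simps power_mult_distrib)
  \<comment> \<open>The order of the roots decides the sign of \<delta>, so either case may occur;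
    the field contains both values.\<close>
  then have "csqrt d = \<delta> * inverse q \<or> csqrt d = - (\<delta> * inverse q)"
    unfolding power2_eq_iff .
  then show ?thesis
    using \<delta>_q closed by metis
qed

text \<open>Reduces each residue class of n to a factorisation of the discriminant and the
  irrationality of one square root.\<close>

lemma quadratic_subfield_of_splitting_field:
  assumes "lead_coeff p = 1" and "discriminant p = q\<^sup>2 * d" and "q \<in> \<rat>" "q \<noteq> 0"
    and "d \<in> \<rat>" "csqrt d \<notin> \<rat>"
  shows "quadratic_field (Q_adjoin {csqrt d}) \<and> Q_adjoin {csqrt d} \<subseteq> splitting_field p"
proof
  show "quadratic_field (Q_adjoin {csqrt d})"
    using assms by (intro quadratic_field_Q_adjoin_sqrt) auto
  show "Q_adjoin {csqrt d} \<subseteq> splitting_field p"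
    using csqrt_discriminant_in_splitting_field[OF assms(1-4)] subfield_Q_adjoin
      Rats_subset_Q_adjoin unfolding splitting_field_def by (intro Q_adjoin_minimal) auto
qed

section \<open>Irrationality of the square roots\<close>

lemma Rats_complex_eq: "(\<rat> :: complex set) = of_real ` \<rat>"
proof -
  have "(of_rat q :: complex) = of_real (of_rat q)" for q
    by (cases q) (simp add: of_rat_rat)
  then show ?thesis
    unfolding Rats_def image_image by simp
qed

lemma csqrt_neg_not_Rats:
  assumes "x < 0"
  shows "csqrt (of_real x) \<notin> \<rat>"
proof
  assume "csqrt (of_real x) \<in> \<rat>"
  then obtain r where "csqrt (of_real x) = of_real r"
    unfolding Rats_complex_eq by auto
  then have "(of_real x :: complex) = of_real (r\<^sup>2)"
    by (metis of_real_power power2_csqrt)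
  then show False
    using assms by (simp only: of_real_eq_iff) simp
qed

text \<open>For a root a/b in lowest terms, m b^2 = a^2 forces b = 1; then a^2 divides the
  square-free m, so a = 1 and m = 1.\<close>

lemma csqrt_squarefree_not_Rats:
  assumes "squarefree m" "m > 1"
  shows "csqrt (of_nat m) \<notin> \<rat>"
proof
  assume "csqrt (of_nat m) \<in> \<rat>"
  then obtain r where r: "csqrt (of_nat m) = of_real r" "r \<in> \<rat>"
    unfolding Rats_complex_eq by auto
  from r(2) obtain a b :: nat where ab: "b \<noteq> 0" "\<bar>r\<bar> = real a / real b" "coprime a b"
    by (rule Rats_abs_nat_div_natE)
  have "(of_real (real m) :: complex) = of_real (r\<^sup>2)"
    by (metis of_real_power power2_csqrt r(1) of_real_of_nat_eq)
  then have "real m = \<bar>r\<bar>\<^sup>2"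
    by (simp only: of_real_eq_iff) simp
  then have "real (m * b\<^sup>2) = real (a\<^sup>2)"
    using ab by (simp add: field_simps)
  then have eq: "m * b\<^sup>2 = a\<^sup>2"
    by (simp only: of_nat_eq_iff)
  have "coprime (b\<^sup>2) (a\<^sup>2)"
    using ab(3) by (simp add: coprime_commute)
  moreover have "b\<^sup>2 dvd a\<^sup>2"
    unfolding eq[symmetric] by simp
  ultimately have "b\<^sup>2 = 1"
    by (metis coprime_absorb_left nat_dvd_1_iff_1)
  then have "a\<^sup>2 dvd m"
    using eq by simp
  then have "a = 1"
    using assms(1) by (auto simp: squarefree_def)
  then show False
    using eq \<open>b\<^sup>2 = 1\<close> assms(2) by simp
qed

section \<open>Sign of the discriminant and the quadratic subfields by n modulo 4\<close>

theorem mainTheorem6: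
  fixes n :: nat
  assumes "n \<ge> 2"
  shows
    "discriminant (f1 n) =
       (-1) ^ ((n - 1) * (n + 2) div 2) * 2
         * of_nat n powi (int n - 3) * of_nat (n + 1) ^ (n - 2)
     \<and> (n mod 4 = 0 \<or> n mod 4 = 3 \<longrightarrow>
          discriminant (f1 n) \<in> \<real> \<and> Re (discriminant (f1 n)) < 0
          \<and> \<not> (\<exists>q :: rat. discriminant (f1 n) = (of_rat q)\<^sup>2))
     \<and> (n > 2 \<longrightarrow> (\<forall>l :: nat.
          (n = 4 * l \<longrightarrow>
             (let F = Q_adjoin {csqrt (- 2 * of_nat l)}
              in quadratic_field F \<and> F \<subseteq> splitting_field (f1 n)))
        \<and> (n = 4 * l + 1 \<and> squarefree (2 * l + 1) \<longrightarrow>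
             (let F = Q_adjoin {csqrt (2 * of_nat l + 1)}
              in quadratic_field F \<and> F \<subseteq> splitting_field (f1 n)))
        \<and> (n = 4 * l + 2 \<and> squarefree (2 * l + 1) \<longrightarrow>
             (let F = Q_adjoin {csqrt (2 * of_nat l + 1)}
              in quadratic_field F \<and> F \<subseteq> splitting_field (f1 n)))
        \<and> (n = 4 * l + 3 \<longrightarrow>
             (let F = Q_adjoin {csqrt (- 2 * (of_nat l + 1))}
              in quadratic_field F \<and> F \<subseteq> splitting_field (f1 n)))))"
proof (intro conjI impI allI)
  show D: "discriminant (f1 n) =
       (-1) ^ ((n - 1) * (n + 2) div 2) * 2
         * of_nat n powi (int n - 3) * of_nat (n + 1) ^ (n - 2)"
    using assms by (rule discriminant_f1)
  \<comment> \<open>A real copy of the discriminant, so that order arguments apply.\<close>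
  define R :: real where
    "R = (-1) ^ ((n - 1) * (n + 2) div 2) * 2 * real n powi (int n - 3) * real (n + 1) ^ (n - 2)"
  have D_R: "discriminant (f1 n) = of_real R"
    by (simp add: D R_def)
  then show "discriminant (f1 n) \<in> \<real>" by simp
  assume n: "n mod 4 = 0 \<or> n mod 4 = 3"
  then have "odd ((n - 1) * (n + 2) div 2)"
    using assms even_sign_exponent[of n] by auto
  then have "R < 0"
    using assms by (simp add: R_def)
  then show "Re (discriminant (f1 n)) < 0"
    by (simp add: D_R)
  show "\<not> (\<exists>q :: rat. discriminant (f1 n) = (of_rat q)\<^sup>2)"
  proof
    assume "\<exists>q :: rat. discriminant (f1 n) = (of_rat q)\<^sup>2"
    then obtain q :: complex where q: "of_real R = q\<^sup>2" "q \<in> \<rat>"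
      unfolding D_R by auto
    then obtain r where "q = of_real r"
      unfolding Rats_complex_eq by auto
    then have "R = r\<^sup>2"
      using q(1) by (metis of_real_eq_iff of_real_power)
    then show False using \<open>R < 0\<close> by simp
  qed
next
  fix l assume "n > 2"
  have monic: "lead_coeff (f1 n) = 1"
    using assms by (intro lead_coeff_f1) simp
  note quadratic = quadratic_subfield_of_splitting_field[OF monic]
  define x y :: complex where "x = of_nat n" and "y = of_nat (n + 1)"
  have nonzero: "2 * x ^ i * y ^ j \<in> \<rat>" "2 * x ^ i * y ^ j \<noteq> 0" for i j
    using assms by (simp_all add: x_def y_def del: of_nat_Suc of_nat_add)
  note D = discriminant_f1_power[of n, folded x_def y_def]
  \<comment> \<open>Exactly one of the exponents n - 3 and n - 2 is odd. Splitting off even powers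
    leaves 2x (n even) or 2y (n odd) up to sign, which is 4 times the radicand; hence the factor 2
    in the rational square root q.\<close>
  have square: "(2 * x ^ i * y ^ j)\<^sup>2 = 4 * x ^ (2 * i) * y ^ (2 * j)" for i j
    by (simp add: power_mult_distrib power_mult mult.commute[of 2])
  show "let F = Q_adjoin {csqrt (- 2 * of_nat l)}
        in quadratic_field F \<and> F \<subseteq> splitting_field (f1 n)" if n: "n = 4 * l"
  proof -
    \<comment> \<open>Writing l = k + 1 removes the truncated subtractions from the
      exponents.\<close>
    obtain k where k: "l = Suc k" using n assms by (cases l) auto
    show ?thesis
      unfolding Let_def
    \<comment> \<open>The rule leaves q open; the factorisation shown first fixes it, and the
      closing step checks that q is rational and nonzero and that the radicand is rational.\<close>
    proof (rule quadratic)
      have "n - 3 = Suc (2 * (2 * k))" "n - 2 = 2 * (2 * k + 1)"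
        using n k by simp_all
      moreover have "- 2 * x = 4 * (- 2 * of_nat l)"
        by (simp add: x_def n)
      ultimately show "discriminant (f1 n) =
          (2 * x ^ (2 * k) * y ^ (2 * k + 1))\<^sup>2 * (- 2 * of_nat l)"
        unfolding square using D n \<open>n > 2\<close> by (simp del: mult_Suc_right)
      show "csqrt (- 2 * of_nat l) \<notin> \<rat>"
        using csqrt_neg_not_Rats[of "- 2 * real l"] k by simp
    qed (rule nonzero | simp)+
  qed
  have irrational: "csqrt (2 * of_nat l + 1) \<notin> \<rat>" if "l > 0" "squarefree (2 * l + 1)"
    using csqrt_squarefree_not_Rats[of "2 * l + 1"] that by (simp add: add.commute)
  show "let F = Q_adjoin {csqrt (2 * of_nat l + 1)}
        in quadratic_field F \<and> F \<subseteq> splitting_field (f1 n)"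
    if n: "n = 4 * l + 1 \<and> squarefree (2 * l + 1)"
  proof -
    obtain k where k: "l = Suc k" using n assms by (cases l) auto
    show ?thesis
      unfolding Let_def
    proof (rule quadratic)
      have "n - 3 = 2 * (2 * k + 1)" "n - 2 = Suc (2 * (2 * k + 1))"
        using n k by simp_all
      moreover have "2 * y = 4 * (2 * of_nat l + 1)"
        by (simp add: y_def n)
      moreover have "n mod 4 = 1"
        using n by simp
      ultimately show "discriminant (f1 n) =
          (2 * x ^ (2 * k + 1) * y ^ (2 * k + 1))\<^sup>2 * (2 * of_nat l + 1)"
        unfolding square using D \<open>n > 2\<close> by simp
      show "csqrt (2 * of_nat l + 1) \<notin> \<rat>"
        using irrational n k by simp
    qed (rule nonzero | simp)+
  qed
  show "let F = Q_adjoin {csqrt (2 * of_nat l + 1)}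
        in quadratic_field F \<and> F \<subseteq> splitting_field (f1 n)"
    if n: "n = 4 * l + 2 \<and> squarefree (2 * l + 1)"
  proof -
    \<comment> \<open>The case l = 0 would be n = 2, with radicand 1; it is excluded by n >
      2.\<close>
    obtain k where k: "l = Suc k" using n \<open>n > 2\<close> by (cases l) auto
    show ?thesis
      unfolding Let_def
    proof (rule quadratic)
      have "n - 3 = Suc (2 * (2 * k + 1))" "n - 2 = 2 * (2 * k + 2)"
        using n k by simp_all
      moreover have "2 * x = 4 * (2 * of_nat l + 1)"
        by (simp add: x_def n)
      moreover have "n mod 4 = 2"
        using n by presburger
      ultimately show "discriminant (f1 n) =
          (2 * x ^ (2 * k + 1) * y ^ (2 * k + 2))\<^sup>2 * (2 * of_nat l + 1)"
        unfolding square using D \<open>n > 2\<close> by simp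
      show "csqrt (2 * of_nat l + 1) \<notin> \<rat>"
        using irrational n k by simp
    qed (rule nonzero | simp)+
  qed
  show "let F = Q_adjoin {csqrt (- 2 * (of_nat l + 1))}
        in quadratic_field F \<and> F \<subseteq> splitting_field (f1 n)" if n: "n = 4 * l + 3"
    unfolding Let_def
  \<comment> \<open>Here l = 0 does occur (n = 3): the exponents are 4l and 4l + 1, and the radicand
    -2(l + 1) is still negative.\<close>
  proof (rule quadratic)
    have "n - 3 = 2 * (2 * l)" "n - 2 = Suc (2 * (2 * l))"
      using n by simp_all
    moreover have "y = 4 * (of_nat l + 1)"
      by (simp add: y_def n)
    moreover have "n mod 4 = 3"
      using n by simp
    ultimately show "discriminant (f1 n) = (2 * x ^ (2 * l) * y ^ (2 * l))\<^sup>2 * (- 2 * (of_nat l + 1))"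
      unfolding square using D \<open>n > 2\<close> by (simp add: algebra_simps)
    show "csqrt (- 2 * (of_nat l + 1)) \<notin> \<rat>"
      using csqrt_neg_not_Rats[of "- 2 * (real l + 1)"] by simp
  qed (rule nonzero | simp)+
qed

end
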